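(* Let $(X,\tau,\mathfrak{M},\mu)$ be a topological measure space. Then the following statements are equivalent. (1) The measure $\mu$ is strongly regular. (2) The weak Lusin theorem holds, i.e., for every measurable function $u:X\to\overline{\mathbb{R}}$ and any $\varepsilon\in(0,\infty)$, there exists a closed set $C_\varepsilon\subseteq X$ such that $\mu(X\setminus C_\varepsilon)<\varepsilon$ and the restriction of $u$ to $C_\varepsilon$ is continuous with respect to the subspace topology $\tau|_{C_\varepsilon}$.
   Context: $\overline{\mathbb{R}}:=[-\infty,\infty]$ with its usual topology. A topological measure space is a quadruple $(X,\tau,\mathfrak{M},\mu)$ where $(X,\tau)$ is a topological space, $\mathfrak{M}$ is a $\sigma$-algebra of subsets of $X$ containing the Borel $\sigma$-algebra of $(X,\tau)$ (equality is not required), and $\mu:\mathfrak{M}\to[0,\infty]$ is a nonnegative measure. Measurable means with respect to $\mathfrak{M}$. The measure $\mu$ is strongly regular if for every $E\in\mathfrak{M}$, $\inf\{\mu(O\setminus C): C \text{ closed},\ O \text{ open},\ C\subseteq E\subseteq O\}=0$. *)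

theory Defs
  imports "HOL-Analysis.Analysis"
begin

text \<open>The underlying set is \<^term>\<open>topspace X\<close>; the \<open>\<sigma>\<close>-algebra and the measure
  are those bundled in \<^term>\<open>M\<close>. The set generated in the second conjunct is the
  Borel \<open>\<sigma>\<close>-algebra of \<^term>\<open>X\<close>; the constant \<open>borel\<close> is only available for
  topologies given by a type class.\<close>

definition topological_measure_space :: "'a topology \<Rightarrow> 'a measure \<Rightarrow> bool" where
  "topological_measure_space X M \<longleftrightarrow>
     space M = topspace X \<and>
     sigma_sets (topspace X) {U. openin X U} \<subseteq> sets M"

definition strongly_regular :: "'a topology \<Rightarrow> 'a measure \<Rightarrow> bool" where
  "strongly_regular X M \<longleftrightarrow>
     (\<forall>E\<in>sets M.
        Inf {emeasure M (U - C) | U C. closedin X C \<and> openin X U \<and> C \<subseteq> E \<and> E \<subseteq> U} = 0)"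

text \<open>Measurability and continuity refer to the order topology on \<^typ>\<open>ereal\<close>, which is
  the usual topology of the extended real line. Functions are total on the type \<open>'a\<close>, but
  both conditions on \<open>u\<close> only depend on its values on \<^term>\<open>topspace X\<close>.\<close>

definition weak_Lusin :: "'a topology \<Rightarrow> 'a measure \<Rightarrow> bool" where
  "weak_Lusin X M \<longleftrightarrow>
     (\<forall>u :: 'a \<Rightarrow> ereal. u \<in> borel_measurable M \<longrightarrow>
       (\<forall>\<epsilon>::real. \<epsilon> > 0 \<longrightarrow>
         (\<exists>C. closedin X C \<and> emeasure M (topspace X - C) < ennreal \<epsilon> \<and>
              continuous_map (subtopology X C) euclidean u)))"

end

theory Submission
  imports Defs
begin

text \<open>
  If every measurable set \<open>E\<close> can be squeezed between a closed \<open>K\<close> and an open \<open>U\<close> with \<open>U - K\<close> of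
  arbitrarily small measure (\<open>strongly_regular_iff_approx\<close>), then off the open set \<open>U - K\<close>
  the set \<open>E\<close> coincides with \<open>U\<close>, so it is relatively open there. The topology
  of the extended reals has a countable basis \<open>B n\<close>, hence \<open>u\<close> becomes continuous after removing
  the countably many open sets \<open>U n - K n\<close> belonging to the preimages of the \<open>B n\<close>. Choosing them
  with measures bounded by a series of small sum keeps the removed set small; it is open, so
  what remains is closed.

  Conversely, if the indicator of \<open>E\<close> is continuous on a closed set \<open>C\<close>, then \<open>E\<close> splits \<open>C\<close> into
  two closed pieces \<open>C \<inter> E\<close> and \<open>C - E\<close>. The set \<open>E\<close> lies between \<open>C \<inter> E\<close> and the complement of
  \<open>C - E\<close>, and these differ by exactly the complement of \<open>C\<close>.
\<close>

lemma openin_imp_sets: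
  assumes "topological_measure_space X M" "openin X U"
  shows "U \<in> sets M"
  using assms unfolding topological_measure_space_def by (blast intro: sigma_sets.Basic)

lemma strongly_regular_iff_approx:
  "strongly_regular X M \<longleftrightarrow>
    (\<forall>E\<in>sets M. \<forall>e::real. e > 0 \<longrightarrow>
      (\<exists>U C. closedin X C \<and> openin X U \<and> C \<subseteq> E \<and> E \<subseteq> U \<and> emeasure M (U - C) < ennreal e))"
  (is "_ \<longleftrightarrow> ?approx")
proof -
  define S where
    "S E = {emeasure M (U - C) | U C. closedin X C \<and> openin X U \<and> C \<subseteq> E \<and> E \<subseteq> U}" for E
  have "Inf (S E) = 0 \<longleftrightarrow> (\<forall>e::real. e > 0 \<longrightarrow> (\<exists>s\<in>S E. s < ennreal e))" for E
  proof
    assume "Inf (S E) = 0"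
    then show "\<forall>e::real. e > 0 \<longrightarrow> (\<exists>s\<in>S E. s < ennreal e)"
      by (simp flip: Inf_less_iff)
  next
    assume approx: "\<forall>e::real. e > 0 \<longrightarrow> (\<exists>s\<in>S E. s < ennreal e)"
    have "Inf (S E) \<le> 0"
    proof (rule ennreal_le_epsilon)
      fix e :: real assume "e > 0"
      then have "Inf (S E) < ennreal e"
        using approx by (simp add: Inf_less_iff)
      then show "Inf (S E) \<le> 0 + ennreal e"
        by simp
    qed
    then show "Inf (S E) = 0" by simp
  qed
  moreover have "(\<exists>s\<in>S E. s < a) \<longleftrightarrow>
      (\<exists>U C. closedin X C \<and> openin X U \<and> C \<subseteq> E \<and> E \<subseteq> U \<and> emeasure M (U - C) < a)" for E a
    unfolding S_def by blast
  ultimately show ?thesis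
    unfolding strongly_regular_def S_def[symmetric] by simp
qed

text \<open>Every open set is a union of basic ones, and preimages commute with unions.\<close>

lemma continuous_map_basisI:
  fixes f :: "'a \<Rightarrow> 'b::topological_space"
  assumes basis: "topological_basis B"
    and preim: "\<And>V. V \<in> B \<Longrightarrow> openin X {x \<in> topspace X. f x \<in> V}"
  shows "continuous_map X euclidean f"
  unfolding continuous_map_def
proof (intro conjI allI impI)
  fix W :: "'b set" assume "openin euclidean W"
  then have "open W" by simp
  then obtain A where A: "A \<subseteq> B" "\<Union>A = W"
    using basis unfolding topological_basis_def by blast
  have "{x \<in> topspace X. f x \<in> W} = (\<Union>V\<in>A. {x \<in> topspace X. f x \<in> V})"
    using A by blast
  also have "openin X \<dots>"
    using A(1) preim by (intro openin_Union) auto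
  finally show "openin X {x \<in> topspace X. f x \<in> W}" .
qed auto

text \<open>The Lusin property does not depend on the extended reals: it holds for functions into any
  space with a countable basis, since only preimages of basic open sets have to be repaired.\<close>

lemma strongly_regular_imp_Lusin:
  fixes u :: "'a \<Rightarrow> 'b::second_countable_topology"
  assumes tms: "topological_measure_space X M"
    and sr: "strongly_regular X M"
    and u: "u \<in> borel_measurable M" and e: "e > 0"
  obtains C where "closedin X C" "emeasure M (topspace X - C) < ennreal e"
    "continuous_map (subtopology X C) euclidean u"
proof -
  obtain \<B> :: "'b set set" where \<B>: "countable \<B>" "topological_basis \<B>"
    using ex_countable_basis by blast
  have "\<B> \<noteq> {}"
    using topological_basisE[OF \<B>(2) open_UNIV UNIV_I] by blast
  then have range: "range (from_nat_into \<B>) = \<B>"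
    using \<B>(1) by (rule range_from_nat_into)
  define E where "E n = {x \<in> topspace X. u x \<in> from_nat_into \<B> n}" for n
  have space: "space M = topspace X"
    using tms by (simp add: topological_measure_space_def)
  have "E n \<in> sets M" for n
  proof -
    have "open (from_nat_into \<B> n)"
      using topological_basis_open[OF \<B>(2)] range by blast
    then have "u -` from_nat_into \<B> n \<inter> space M \<in> sets M"
      using u by (intro measurable_sets[OF u]) auto
    also have "u -` from_nat_into \<B> n \<inter> space M = E n"
      using space by (auto simp: E_def)
    finally show ?thesis .
  qed
  then have "\<forall>n. \<exists>U K. closedin X K \<and> openin X U \<and> K \<subseteq> E n \<and> E n \<subseteq> U
      \<and> emeasure M (U - K) < ennreal (e / 2 * (1/2) ^ Suc n)"
    using sr e unfolding strongly_regular_iff_approx by simp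
  then obtain U K where UK: "\<And>n. closedin X (K n)" "\<And>n. openin X (U n)"
      "\<And>n. K n \<subseteq> E n" "\<And>n. E n \<subseteq> U n"
      "\<And>n. emeasure M (U n - K n) < ennreal (e / 2 * (1/2) ^ Suc n)"
    by metis
  have gap_open: "openin X (U n - K n)" for n
    using UK(2,1) by (rule openin_diff)
  define N where "N = (\<Union>n. U n - K n)"
  have N_open: "openin X N"
    unfolding N_def using gap_open by blast
  define C where "C = topspace X - N"
  have C_closed: "closedin X C"
    unfolding C_def using N_open by (rule closedin_diff[OF closedin_topspace])
  have C_compl: "topspace X - C = N"
    using openin_subset[OF N_open] by (auto simp: C_def)

  have "emeasure M N \<le> (\<Sum>n. emeasure M (U n - K n))"
    unfolding N_def using openin_imp_sets[OF tms gap_open]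
    by (intro emeasure_subadditive_countably) blast
  also have "\<dots> \<le> (\<Sum>n. ennreal (e / 2 * (1/2) ^ Suc n))"
    using UK(5) by (intro suminf_le) (auto intro: less_imp_le)
  also have "\<dots> = ennreal (e / 2)"
    using e sums_mult[OF power_half_series, of "e / 2"]
    by (intro suminf_ennreal_eq) auto
  also have "\<dots> < ennreal e"
    using e by (simp add: ennreal_less_iff)
  finally have small: "emeasure M (topspace X - C) < ennreal e"
    by (simp add: C_compl)

  have cont: "continuous_map (subtopology X C) euclidean u"
  proof (rule continuous_map_basisI[OF \<B>(2)])
    fix V assume "V \<in> \<B>"
    then obtain n where n: "V = from_nat_into \<B> n"
      using range by blast
    \<comment> \<open>Points of \<open>U n\<close> outside \<open>E n\<close> would lie in the removed set.\<close>
    have "U n \<inter> C \<subseteq> E n"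
      using UK(3) by (auto simp: C_def N_def)
    then have "{x \<in> topspace (subtopology X C). u x \<in> V} = U n \<inter> C"
      using UK(4)[of n] by (auto simp: E_def n C_def)
    then show "openin (subtopology X C) {x \<in> topspace (subtopology X C). u x \<in> V}"
      using UK(2) by (auto simp: openin_subtopology)
  qed
  show thesis
    using that C_closed small cont .
qed

lemma weak_Lusin_imp_strongly_regular:
  assumes tms: "topological_measure_space X M" and wl: "weak_Lusin X M"
  shows "strongly_regular X M"
  unfolding strongly_regular_iff_approx
proof (intro ballI allI impI)
  fix E and e :: real
  assume E: "E \<in> sets M" and e: "e > 0"
  let ?u = "indicator E :: 'a \<Rightarrow> ereal"
  have EX: "E \<subseteq> topspace X"
    using tms sets.sets_into_space[OF E] by (simp add: topological_measure_space_def)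
  have "?u \<in> borel_measurable M"
    using E by simp
  then obtain C where C: "closedin X C" "emeasure M (topspace X - C) < ennreal e"
      "continuous_map (subtopology X C) euclidean ?u"
    using wl e unfolding weak_Lusin_def by blast
  have CX: "C \<subseteq> topspace X"
    using C(1) by (rule closedin_subset)
  have preim: "closedin X {x \<in> C. ?u x \<in> {a}}" for a
  proof -
    have "closedin (subtopology X C) {x \<in> topspace (subtopology X C). ?u x \<in> {a}}"
      by (rule closedin_continuous_map_preimage[OF C(3)]) simp
    moreover have "topspace (subtopology X C) = C"
      using CX by auto
    ultimately show ?thesis
      using C(1) closedin_trans_full by metis
  qed
  have "{x \<in> C. ?u x \<in> {1}} = C \<inter> E" "{x \<in> C. ?u x \<in> {0}} = C - E"
    by (auto simp: indicator_def)
  then have closed: "closedin X (C \<inter> E)" "closedin X (C - E)"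
    using preim[of 1] preim[of 0] by simp_all
  have "(topspace X - (C - E)) - C \<inter> E = topspace X - C"
    by blast
  then show "\<exists>U K. closedin X K \<and> openin X U \<and> K \<subseteq> E \<and> E \<subseteq> U \<and> emeasure M (U - K) < ennreal e"
    using closed C(2) EX
    by (intro exI[of _ "topspace X - (C - E)"] exI[of _ "C \<inter> E"]) auto
qed

theorem theorem3p6:
  fixes X :: "'a topology" and M :: "'a measure"
  assumes "topological_measure_space X M"
  shows "strongly_regular X M \<longleftrightarrow> weak_Lusin X M"
proof
  assume sr: "strongly_regular X M"
  show "weak_Lusin X M"
    unfolding weak_Lusin_def
  proof (intro allI impI)
    fix u :: "'a \<Rightarrow> ereal" and e :: real
    assume "u \<in> borel_measurable M" "e > 0"
    then obtain C where "closedin X C" "emeasure M (topspace X - C) < ennreal e"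
        "continuous_map (subtopology X C) euclidean u"
      by (rule strongly_regular_imp_Lusin[OF assms sr])
    then show "\<exists>C. closedin X C \<and> emeasure M (topspace X - C) < ennreal e \<and>
        continuous_map (subtopology X C) euclidean u"
      by blast
  qed
next
  assume "weak_Lusin X M"
  then show "strongly_regular X M"
    by (rule weak_Lusin_imp_strongly_regular[OF assms])
qed

end
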